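(* An infinite minimal divisive meadow admits transformation into simple fractions for closed terms only if it is isomorphic to $\mathbb{Q}_0$.
   Context: Let $\Sigma$ be the signature with constants $0,1$, binary operators $+$, $\cdot$, $/$ and unary operator $-$. Terms over $\Sigma$ are built as usual from variables; closed terms contain no variables. A divisive meadow is a total algebra over $\Sigma$ satisfying the set $E$ of the following equations: $(x+y)+z=x+(y+z)$, $x+y=y+x$, $x+0=x$, $x+(-x)=0$, $(x\cdot y)\cdot z=x\cdot(y\cdot z)$, $x\cdot y=y\cdot x$, $x\cdot 1=x$, $x\cdot(y+z)=x\cdot y+x\cdot z$, $1/(1/x)=x$, $(x\cdot x)/x=x$, $x/y=x\cdot(1/y)$. A divisive meadow is infinite if its carrier is infinite, and minimal if it has no proper subalgebra (over $\Sigma$). $\mathbb{Q}_0$ is the divisive meadow with carrier the rational numbers, the usual $0,1,+,\cdot,-$, and total division with $x/0=0$ and $x/y$ the usual quotient if $y\neq 0$. A fraction is a term over $\Sigma$ whose outermost operator is $/$. A simple closed fraction is a closed term that is a fraction of which no proper subterm is a fraction. A divisive meadow $M$ admits transformation into simple fractions for closed terms if, for each closed term $p$ over $\Sigma$, there exists a simple closed fraction $q$ such that $M\models p=q$. *)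

theory Defs
  imports Complex_Main "HOL-Algebra.Ring"
begin

datatype 'v trm =
    Var 'v
  | Zero
  | One
  | Add "'v trm" "'v trm"  (infixl "+\<^sub>t" 65)
  | Mul "'v trm" "'v trm"  (infixl "*\<^sub>t" 70)
  | Div "'v trm" "'v trm"  (infixl "'/\<^sub>t" 70)
  | Neg "'v trm"  ("-\<^sub>t _" [81] 80)

definition closed_trm :: "'v trm \<Rightarrow> bool" where
  "closed_trm t \<longleftrightarrow> set_trm t = {}"

text \<open>The operations are functions on the whole type; that the carrier is closed under them is
  required by \<open>sigma_algebra\<close> below. The field \<open>neg\<close> is the unary minus of the signature; it is
  unrelated a priori to the additive inverse \<open>a_inv\<close> derived from the ring operations.\<close>

record 'a sigma = "'a ring" +
  neg :: "'a \<Rightarrow> 'a"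
  quot :: "'a \<Rightarrow> 'a \<Rightarrow> 'a"

definition closed_under_ops :: "('a, 'm) sigma_scheme \<Rightarrow> 'a set \<Rightarrow> bool" where
  "closed_under_ops M S \<longleftrightarrow>
     \<zero>\<^bsub>M\<^esub> \<in> S \<and> \<one>\<^bsub>M\<^esub> \<in> S \<and>
     (\<forall>x\<in>S. \<forall>y\<in>S. x \<oplus>\<^bsub>M\<^esub> y \<in> S \<and> x \<otimes>\<^bsub>M\<^esub> y \<in> S \<and> quot M x y \<in> S) \<and>
     (\<forall>x\<in>S. neg M x \<in> S)"

definition sigma_algebra :: "('a, 'm) sigma_scheme \<Rightarrow> bool" where
  "sigma_algebra M \<longleftrightarrow> closed_under_ops M (carrier M)"

primrec eval_trm :: "('a, 'm) sigma_scheme \<Rightarrow> ('v \<Rightarrow> 'a) \<Rightarrow> 'v trm \<Rightarrow> 'a" where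
  "eval_trm M \<rho> (Var v) = \<rho> v"
| "eval_trm M \<rho> Zero = \<zero>\<^bsub>M\<^esub>"
| "eval_trm M \<rho> One = \<one>\<^bsub>M\<^esub>"
| "eval_trm M \<rho> (s +\<^sub>t t) = eval_trm M \<rho> s \<oplus>\<^bsub>M\<^esub> eval_trm M \<rho> t"
| "eval_trm M \<rho> (s *\<^sub>t t) = eval_trm M \<rho> s \<otimes>\<^bsub>M\<^esub> eval_trm M \<rho> t"
| "eval_trm M \<rho> (s /\<^sub>t t) = quot M (eval_trm M \<rho> s) (eval_trm M \<rho> t)"
| "eval_trm M \<rho> (-\<^sub>t t) = neg M (eval_trm M \<rho> t)"

definition models_eq :: "('a, 'm) sigma_scheme \<Rightarrow> 'v trm \<Rightarrow> 'v trm \<Rightarrow> bool" where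
  "models_eq M s t \<longleftrightarrow> (\<forall>\<rho>. range \<rho> \<subseteq> carrier M \<longrightarrow> eval_trm M \<rho> s = eval_trm M \<rho> t)"

definition meadow_eqs :: "(nat trm \<times> nat trm) set" where
  "meadow_eqs =
    (let x = Var 0; y = Var 1; z = Var 2 in
     {((x +\<^sub>t y) +\<^sub>t z, x +\<^sub>t (y +\<^sub>t z)),
      (x +\<^sub>t y, y +\<^sub>t x),
      (x +\<^sub>t Zero, x),
      (x +\<^sub>t (-\<^sub>t x), Zero),
      ((x *\<^sub>t y) *\<^sub>t z, x *\<^sub>t (y *\<^sub>t z)),
      (x *\<^sub>t y, y *\<^sub>t x),
      (x *\<^sub>t One, x),
      (x *\<^sub>t (y +\<^sub>t z), (x *\<^sub>t y) +\<^sub>t (x *\<^sub>t z)),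
      (One /\<^sub>t (One /\<^sub>t x), x),
      ((x *\<^sub>t x) /\<^sub>t x, x),
      (x /\<^sub>t y, x *\<^sub>t (One /\<^sub>t y))})"

definition divisive_meadow :: "('a, 'm) sigma_scheme \<Rightarrow> bool" where
  "divisive_meadow M \<longleftrightarrow> sigma_algebra M \<and> (\<forall>(s, t) \<in> meadow_eqs. models_eq M s t)"

definition minimal_algebra :: "('a, 'm) sigma_scheme \<Rightarrow> bool" where
  "minimal_algebra M \<longleftrightarrow> \<not> (\<exists>S. S \<subset> carrier M \<and> closed_under_ops M S)"

text \<open>Division in the type of rationals is already total with \<open>x / 0 = 0\<close>.\<close>

definition Q0 :: "rat sigma" where
  "Q0 = \<lparr>carrier = UNIV, monoid.mult = (*), one = 1, zero = 0, add = (+),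
         neg = uminus, quot = (/)\<rparr>"

definition sigma_iso ::
    "('a, 'm) sigma_scheme \<Rightarrow> ('b, 'n) sigma_scheme \<Rightarrow> ('a \<Rightarrow> 'b) set" where
  "sigma_iso M N =
    {h. bij_betw h (carrier M) (carrier N) \<and>
        h \<zero>\<^bsub>M\<^esub> = \<zero>\<^bsub>N\<^esub> \<and> h \<one>\<^bsub>M\<^esub> = \<one>\<^bsub>N\<^esub> \<and>
        (\<forall>x\<in>carrier M. \<forall>y\<in>carrier M.
            h (x \<oplus>\<^bsub>M\<^esub> y) = h x \<oplus>\<^bsub>N\<^esub> h y \<and>
            h (x \<otimes>\<^bsub>M\<^esub> y) = h x \<otimes>\<^bsub>N\<^esub> h y \<and>
            h (quot M x y) = quot N (h x) (h y)) \<and>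
        (\<forall>x\<in>carrier M. h (neg M x) = neg N (h x))}"

definition sigma_isomorphic :: "('a, 'm) sigma_scheme \<Rightarrow> ('b, 'n) sigma_scheme \<Rightarrow> bool" where
  "sigma_isomorphic M N \<longleftrightarrow> sigma_iso M N \<noteq> {}"

definition fraction :: "'v trm \<Rightarrow> bool" where
  "fraction t \<longleftrightarrow> (\<exists>r s. t = r /\<^sub>t s)"

primrec proper_subterms :: "'v trm \<Rightarrow> 'v trm set" where
  "proper_subterms (Var v) = {}"
| "proper_subterms Zero = {}"
| "proper_subterms One = {}"
| "proper_subterms (s +\<^sub>t t) = {s, t} \<union> proper_subterms s \<union> proper_subterms t"
| "proper_subterms (s *\<^sub>t t) = {s, t} \<union> proper_subterms s \<union> proper_subterms t"
| "proper_subterms (s /\<^sub>t t) = {s, t} \<union> proper_subterms s \<union> proper_subterms t"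
| "proper_subterms (-\<^sub>t t) = {t} \<union> proper_subterms t"

definition simple_closed_fraction :: "'v trm \<Rightarrow> bool" where
  "simple_closed_fraction t \<longleftrightarrow>
     closed_trm t \<and> fraction t \<and> (\<forall>s \<in> proper_subterms t. \<not> fraction s)"

definition admits_simple_fractions_closed :: "('a, 'm) sigma_scheme \<Rightarrow> bool" where
  "admits_simple_fractions_closed M \<longleftrightarrow>
     (\<forall>p :: nat trm. closed_trm p \<longrightarrow>
        (\<exists>q :: nat trm. simple_closed_fraction q \<and> models_eq M p q))"

end

theory Submission
  imports Defs
begin

text \<open>Let \<open>n\<close> be a nonzero integer. The element \<open>f = 1 - n \<cdot> (1/n)\<close> of the meadow satisfies
  \<open>n \<cdot> f = 0\<close>. If \<open>f = a/b\<close> with integers \<open>a\<close> and \<open>b\<close>, then multiplication by \<open>n \<cdot> b \<cdot> b\<close> gives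
  \<open>n \<cdot> a \<cdot> b = 0\<close>. An infinite meadow all of whose elements are of the form \<open>a/b\<close> has
  characteristic zero, so \<open>a = 0\<close> or \<open>b = 0\<close>, and in both cases \<open>f = 0\<close>. Hence every nonzero integer
  is invertible, so that the rationals embed into the meadow, onto its smallest subalgebra.\<close>

text \<open>The rationals will be mapped into the meadow, whereas the goal asks for the opposite
  direction. Closure of the carrier of \<open>N\<close> matters because \<open>h\<close> undoes
  \<open>g\<close> only there.\<close>

lemma sigma_isomorphic_sym:
  assumes "sigma_isomorphic N M" and alg: "sigma_algebra N"
  shows "sigma_isomorphic M N"
proof -
  from assms(1) obtain g where bij: "bij_betw g (carrier N) (carrier M)"
    and g: "g \<zero>\<^bsub>N\<^esub> = \<zero>\<^bsub>M\<^esub>" "g \<one>\<^bsub>N\<^esub> = \<one>\<^bsub>M\<^esub>"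
      "\<And>x y. x \<in> carrier N \<Longrightarrow> y \<in> carrier N \<Longrightarrow> g (x \<oplus>\<^bsub>N\<^esub> y) = g x \<oplus>\<^bsub>M\<^esub> g y"
      "\<And>x y. x \<in> carrier N \<Longrightarrow> y \<in> carrier N \<Longrightarrow> g (x \<otimes>\<^bsub>N\<^esub> y) = g x \<otimes>\<^bsub>M\<^esub> g y"
      "\<And>x y. x \<in> carrier N \<Longrightarrow> y \<in> carrier N \<Longrightarrow> g (quot N x y) = quot M (g x) (g y)"
      "\<And>x. x \<in> carrier N \<Longrightarrow> g (neg N x) = neg M (g x)"
    by (auto simp: sigma_isomorphic_def sigma_iso_def)
  define h where "h = the_inv_into (carrier N) g"
  have hg: "h (g x) = x" if "x \<in> carrier N" for x
    using that bij by (simp add: h_def bij_betw_def the_inv_into_f_f)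
  have onto: "carrier M = g ` carrier N"
    using bij by (simp add: bij_betw_def)
  have closed:
    "\<zero>\<^bsub>N\<^esub> \<in> carrier N" "\<one>\<^bsub>N\<^esub> \<in> carrier N"
    "\<And>x y. x \<in> carrier N \<Longrightarrow> y \<in> carrier N \<Longrightarrow> x \<oplus>\<^bsub>N\<^esub> y \<in> carrier N"
    "\<And>x y. x \<in> carrier N \<Longrightarrow> y \<in> carrier N \<Longrightarrow> x \<otimes>\<^bsub>N\<^esub> y \<in> carrier N"
    "\<And>x y. x \<in> carrier N \<Longrightarrow> y \<in> carrier N \<Longrightarrow> quot N x y \<in> carrier N"
    "\<And>x. x \<in> carrier N \<Longrightarrow> neg N x \<in> carrier N"
    using alg by (auto simp: sigma_algebra_def closed_under_ops_def)
  have "bij_betw h (carrier M) (carrier N)"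
    unfolding h_def by (rule bij_betw_the_inv_into[OF bij])
  moreover have "h \<zero>\<^bsub>M\<^esub> = \<zero>\<^bsub>N\<^esub>" "h \<one>\<^bsub>M\<^esub> = \<one>\<^bsub>N\<^esub>"
    by (simp_all add: hg closed flip: g)
  moreover have "h (x \<oplus>\<^bsub>M\<^esub> y) = h x \<oplus>\<^bsub>N\<^esub> h y" "h (x \<otimes>\<^bsub>M\<^esub> y) = h x \<otimes>\<^bsub>N\<^esub> h y"
    "h (quot M x y) = quot N (h x) (h y)" "h (neg M x) = neg N (h x)"
    if xy: "x \<in> carrier M" "y \<in> carrier M" for x y
  proof -
    obtain u v where "x = g u" "y = g v" "u \<in> carrier N" "v \<in> carrier N"
      using xy unfolding onto by blast
    then show "h (x \<oplus>\<^bsub>M\<^esub> y) = h x \<oplus>\<^bsub>N\<^esub> h y" "h (x \<otimes>\<^bsub>M\<^esub> y) = h x \<otimes>\<^bsub>N\<^esub> h y"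
      "h (quot M x y) = quot N (h x) (h y)" "h (neg M x) = neg N (h x)"
      by (simp_all add: hg closed flip: g)
  qed
  ultimately have "h \<in> sigma_iso M N"
    by (simp add: sigma_iso_def)
  then show ?thesis
    by (auto simp: sigma_isomorphic_def)
qed

section \<open>Divisive meadows as commutative rings\<close>

locale meadow = cring M for M :: "('a, 'm) sigma_scheme" (structure) +
  assumes quot_closed: "x \<in> carrier M \<Longrightarrow> y \<in> carrier M \<Longrightarrow> quot M x y \<in> carrier M"
    and quot_quot: "x \<in> carrier M \<Longrightarrow> quot M \<one> (quot M \<one> x) = x"
    and mult_self_quot: "x \<in> carrier M \<Longrightarrow> quot M (x \<otimes> x) x = x"
    and quot_eq: "x \<in> carrier M \<Longrightarrow> y \<in> carrier M \<Longrightarrow> quot M x y = x \<otimes> quot M \<one> y"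
    and neg_eq: "x \<in> carrier M \<Longrightarrow> neg M x = \<ominus> x"

text \<open>Read as laws on elements, the equations yield a commutative ring; uniqueness of additive
  inverses then identifies \<open>neg M\<close> with \<open>a_inv\<close>.\<close>

lemma divisive_meadow_imp_meadow:
  fixes M :: "('a, 'm) sigma_scheme" (structure)
  assumes "divisive_meadow M"
  shows "meadow M"
proof -
  have alg: "\<zero> \<in> carrier M" "\<one> \<in> carrier M"
    "\<And>x y. x \<in> carrier M \<Longrightarrow> y \<in> carrier M \<Longrightarrow> x \<oplus> y \<in> carrier M"
    "\<And>x y. x \<in> carrier M \<Longrightarrow> y \<in> carrier M \<Longrightarrow> x \<otimes> y \<in> carrier M"
    "\<And>x y. x \<in> carrier M \<Longrightarrow> y \<in> carrier M \<Longrightarrow> quot M x y \<in> carrier M"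
    "\<And>x. x \<in> carrier M \<Longrightarrow> neg M x \<in> carrier M"
    using assms by (auto simp: divisive_meadow_def sigma_algebra_def closed_under_ops_def)
  have eqs: "\<forall>(s, t) \<in> meadow_eqs. eval_trm M \<rho> s = eval_trm M \<rho> t"
    if "range \<rho> \<subseteq> carrier M" for \<rho>
    using assms that unfolding divisive_meadow_def models_eq_def by blast
  have E: "(x \<oplus> y) \<oplus> z = x \<oplus> (y \<oplus> z)" "x \<oplus> y = y \<oplus> x" "x \<oplus> \<zero> = x" "x \<oplus> neg M x = \<zero>"
    "(x \<otimes> y) \<otimes> z = x \<otimes> (y \<otimes> z)" "x \<otimes> y = y \<otimes> x" "x \<otimes> \<one> = x"
    "x \<otimes> (y \<oplus> z) = x \<otimes> y \<oplus> x \<otimes> z" "quot M \<one> (quot M \<one> x) = x"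
    "quot M (x \<otimes> x) x = x" "quot M x y = x \<otimes> quot M \<one> y"
    if "x \<in> carrier M" "y \<in> carrier M" "z \<in> carrier M" for x y z
  proof -
    \<comment> \<open>One valuation serves all equations. The default \<open>z\<close> keeps the
      variables beyond the third in the carrier too, as \<open>models_eq\<close> requires.\<close>
    let ?\<rho> = "\<lambda>i::nat. if i = 0 then x else if i = 1 then y else z"
    have "range ?\<rho> \<subseteq> carrier M"
      using that by auto
    from eqs[OF this]
    show "(x \<oplus> y) \<oplus> z = x \<oplus> (y \<oplus> z)" "x \<oplus> y = y \<oplus> x" "x \<oplus> \<zero> = x" "x \<oplus> neg M x = \<zero>"
      "(x \<otimes> y) \<otimes> z = x \<otimes> (y \<otimes> z)" "x \<otimes> y = y \<otimes> x" "x \<otimes> \<one> = x"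
      "x \<otimes> (y \<oplus> z) = x \<otimes> y \<oplus> x \<otimes> z" "quot M \<one> (quot M \<one> x) = x"
      "quot M (x \<otimes> x) x = x" "quot M x y = x \<otimes> quot M \<one> y"
      unfolding meadow_eqs_def Let_def by (simp_all (no_asm_use)) (elim conjE, assumption)+
  qed
  have cr: "cring M"
  proof (intro cringI abelian_groupI comm_monoidI)
    fix x y z assume x: "x \<in> carrier M" and y: "y \<in> carrier M" and z: "z \<in> carrier M"
    show "x \<oplus> y \<oplus> z = x \<oplus> (y \<oplus> z)" "x \<otimes> y \<otimes> z = x \<otimes> (y \<otimes> z)"
      by (rule E(1)[OF x y z] E(5)[OF x y z])+
    \<comment> \<open>The equations state distributivity on the other side; commutativity carries it
      over.\<close>
    show "(x \<oplus> y) \<otimes> z = x \<otimes> z \<oplus> y \<otimes> z"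
      using E(8)[OF z x y] E(6)[OF z x x] E(6)[OF z y y] E(6)[OF z alg(3)[OF x y] z] by metis
  next
    fix x y assume x: "x \<in> carrier M" and y: "y \<in> carrier M"
    show "x \<oplus> y = y \<oplus> x" "x \<otimes> y = y \<otimes> x"
      by (rule E(2)[OF x y y] E(6)[OF x y y])+
  next
    fix x assume x: "x \<in> carrier M"
    show "\<zero> \<oplus> x = x"
      using E(2)[OF alg(1) x x] E(3)[OF x x x] by metis
    show "\<one> \<otimes> x = x"
      using E(6)[OF alg(2) x x] E(7)[OF x x x] by metis
    show "\<exists>y \<in> carrier M. y \<oplus> x = \<zero>"
      using E(2)[OF alg(6)[OF x] x x] E(4)[OF x x x] alg(6)[OF x] by metis
  qed (use alg in blast)+
  then interpret cring M .
  show ?thesis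
  proof unfold_locales
    fix x assume x: "x \<in> carrier M"
    show "neg M x = \<ominus> x"
      using x E(4)[OF x x x] alg(6)[OF x] by (metis a_comm minus_equality)
    show "quot M \<one> (quot M \<one> x) = x" "quot M (x \<otimes> x) x = x"
      by (rule E(9)[OF x x x] E(10)[OF x x x])+
    fix y assume y: "y \<in> carrier M"
    show "quot M x y = x \<otimes> quot M \<one> y"
      by (rule E(11)[OF x y y])
  qed (use alg in blast)
qed

section \<open>Integers and reciprocals in a meadow\<close>

context meadow
begin

text \<open>The canonical ring homomorphism from the integers.\<close>

abbreviation of_Z :: "int \<Rightarrow> 'a" where
  "of_Z k \<equiv> [k] \<cdot> \<one>"

abbreviation recip :: "'a \<Rightarrow> 'a" where
  "recip x \<equiv> quot M \<one> x"

lemma recip_closed [simp, intro]: "x \<in> carrier M \<Longrightarrow> recip x \<in> carrier M"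
  by (simp add: quot_closed)

lemma of_Z_0 [simp]: "of_Z 0 = \<zero>"
  by (simp add: add_pow_def)

lemma of_Z_add: "of_Z (a + b) = of_Z a \<oplus> of_Z b"
  by (simp add: add.int_pow_mult)

lemma of_Z_neg: "of_Z (- a) = \<ominus> of_Z a"
  by (simp add: add.int_pow_neg)

lemma of_Z_mult: "of_Z (a * b) = of_Z a \<otimes> of_Z b"
  by (simp add: add_pow_ldistr_int add.int_pow_pow mult.commute)

lemma mult_mult_recip:
  assumes "x \<in> carrier M" shows "x \<otimes> x \<otimes> recip x = x"
  using mult_self_quot[OF assms] quot_eq[of "x \<otimes> x" x] assms by simp

text \<open>Reciprocation is an involution, so the left side of \<open>mult_mult_recip\<close> at
  \<open>recip \<zero>\<close> has the factor zero.\<close>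

lemma recip_zero: "recip \<zero> = \<zero>"
  using mult_mult_recip[of "recip \<zero>"] by (simp add: quot_quot)

text \<open>Multiplying \<open>x \<otimes> recip x\<close> by \<open>x \<otimes> y\<close>, which is
  one, exposes \<open>x \<otimes> x \<otimes> recip x = x\<close>. So \<open>recip x\<close> is an
  inverse of \<open>x\<close> too, and inverses are unique.\<close>

lemma recip_unique:
  assumes "x \<in> carrier M" "y \<in> carrier M" "x \<otimes> y = \<one>"
  shows "recip x = y"
proof -
  have "x \<otimes> recip x = x \<otimes> y \<otimes> (x \<otimes> recip x)"
    using assms by simp
  also have "\<dots> = y \<otimes> (x \<otimes> x \<otimes> recip x)"
    using assms(1,2) by (simp add: m_ac)
  also have "\<dots> = x \<otimes> y"
    using assms(1,2) by (simp add: mult_mult_recip m_comm)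
  finally have "x \<otimes> recip x = \<one>" using assms(3) by simp
  then show ?thesis
    using assms by (metis inv_unique m_comm recip_closed)
qed

section \<open>Values of closed terms\<close>

lemma eval_fraction_free:
  assumes "closed_trm t" "\<not> fraction t" "\<forall>s \<in> proper_subterms t. \<not> fraction s"
  shows "eval_trm M \<rho> t \<in> range of_Z"
  using assms
proof (induction t)
  case Zero
  show ?case by (simp add: image_iff) (metis of_Z_0)
next
  case One
  have "\<one> = of_Z 1" by (simp add: add.int_pow_1)
  then show ?case by (metis eval_trm.simps(3) rangeI)
next
  case (Add s t)
  then obtain a b where "eval_trm M \<rho> s = of_Z a" "eval_trm M \<rho> t = of_Z b"
    by (auto simp: closed_trm_def)
  then show ?case by (simp flip: of_Z_add)
next
  case (Mul s t)
  then obtain a b where "eval_trm M \<rho> s = of_Z a" "eval_trm M \<rho> t = of_Z b"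
    by (auto simp: closed_trm_def)
  then show ?case by (simp flip: of_Z_mult)
next
  case (Neg t)
  then obtain a where "eval_trm M \<rho> t = of_Z a"
    by (auto simp: closed_trm_def)
  then show ?case by (simp add: neg_eq flip: of_Z_neg)
\<comment> \<open>A variable is not closed, and a quotient is itself a fraction.\<close>
qed (auto simp: closed_trm_def fraction_def)

text \<open>The only division is the outermost one, so numerator and denominator both evaluate to
  integers.\<close>

lemma eval_simple_closed_fraction:
  assumes "simple_closed_fraction t"
  obtains a b where "eval_trm M \<rho> t = of_Z a \<otimes> recip (of_Z b)"
proof -
  from assms obtain r s where t: "t = r /\<^sub>t s" "closed_trm r" "closed_trm s"
    by (auto simp: simple_closed_fraction_def fraction_def closed_trm_def)
  then have "eval_trm M \<rho> r \<in> range of_Z" "eval_trm M \<rho> s \<in> range of_Z"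
    using assms by (auto intro!: eval_fraction_free simp: simple_closed_fraction_def)
  then obtain a b where "eval_trm M \<rho> r = of_Z a" "eval_trm M \<rho> s = of_Z b" by auto
  then show thesis
    using that[of a b] t by (simp add: quot_eq[of "of_Z a"])
qed

lemma sigma_algebra: "sigma_algebra M"
  by (auto simp: sigma_algebra_def closed_under_ops_def quot_closed neg_eq)

lemma eval_closed_trm_in_carrier:
  "closed_trm t \<Longrightarrow> eval_trm M \<rho> t \<in> carrier M"
  using sigma_algebra
  by (induction t) (auto simp: closed_trm_def sigma_algebra_def closed_under_ops_def)

text \<open>By minimality, this makes every element of the carrier the value of a closed
  term.\<close>

lemma closed_under_ops_eval_closed_trms:
  "closed_under_ops M (eval_trm M \<rho> ` {t. closed_trm t})"
  unfolding closed_under_ops_def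
proof (intro conjI ballI)
  let ?S = "eval_trm M \<rho> ` {t. closed_trm t}"
  show "\<zero> \<in> ?S"
    by (rule image_eqI[of _ _ Zero]) (auto simp: closed_trm_def)
  show "\<one> \<in> ?S"
    by (rule image_eqI[of _ _ One]) (auto simp: closed_trm_def)
  fix x assume "x \<in> ?S"
  then obtain s where s: "x = eval_trm M \<rho> s" "closed_trm s" by auto
  show "neg M x \<in> ?S"
    by (rule image_eqI[of _ _ "-\<^sub>t s"]) (use s in \<open>auto simp: closed_trm_def\<close>)
  fix y assume "y \<in> ?S"
  then obtain t where t: "y = eval_trm M \<rho> t" "closed_trm t" by auto
  show "x \<oplus> y \<in> ?S"
    by (rule image_eqI[of _ _ "s +\<^sub>t t"]) (use s t in \<open>auto simp: closed_trm_def\<close>)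
  show "x \<otimes> y \<in> ?S"
    by (rule image_eqI[of _ _ "s *\<^sub>t t"]) (use s t in \<open>auto simp: closed_trm_def\<close>)
  show "quot M x y \<in> ?S"
    by (rule image_eqI[of _ _ "s /\<^sub>t t"]) (use s t in \<open>auto simp: closed_trm_def\<close>)
qed

lemma minimal_algebra_carrier_eq:
  assumes "minimal_algebra M" "closed_under_ops M S" "S \<subseteq> carrier M"
  shows "S = carrier M"
  using assms by (auto simp: minimal_algebra_def)

lemma element_is_fraction:
  assumes "minimal_algebra M" "admits_simple_fractions_closed M" "x \<in> carrier M"
  obtains a b where "x = of_Z a \<otimes> recip (of_Z b)"
proof -
  \<comment> \<open>Closed terms ignore the valuation; a constant one in the carrier suffices to
    apply \<open>models_eq\<close>.\<close>
  define \<rho> :: "nat \<Rightarrow> 'a" where "\<rho> = (\<lambda>_. \<zero>)"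
  have "eval_trm M \<rho> ` {t. closed_trm t} = carrier M"
    using assms(1) closed_under_ops_eval_closed_trms eval_closed_trm_in_carrier
    by (intro minimal_algebra_carrier_eq) auto
  with assms(3) obtain p where p: "closed_trm p" "x = eval_trm M \<rho> p"
    by blast
  then obtain q where q: "simple_closed_fraction q" "models_eq M p q"
    using assms(2) by (auto simp: admits_simple_fractions_closed_def)
  have "x = eval_trm M \<rho> q"
    using p q by (auto simp: models_eq_def \<rho>_def)
  with eval_simple_closed_fraction[OF q(1), of \<rho>] that show thesis by metis
qed

section \<open>Characteristic zero and invertibility of nonzero integers\<close>

lemma finite_range_of_Z:
  assumes "of_Z n = \<zero>" "n \<noteq> 0"
  shows "finite (range of_Z)"
proof -
  have mod: "of_Z k = of_Z (k mod n)" for k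
  proof -
    have "of_Z k = of_Z (n * (k div n) + k mod n)" by simp
    also have "\<dots> = of_Z (k mod n)"
      unfolding of_Z_add of_Z_mult using assms(1) by simp
    finally show ?thesis .
  qed
  \<comment> \<open>The interval is symmetric because \<open>n\<close> may be negative, and
    \<open>k mod n\<close> is then at most zero.\<close>
  have "range of_Z \<subseteq> of_Z ` {- \<bar>n\<bar>..\<bar>n\<bar>}"
  proof (intro image_subsetI)
    fix k
    have "k mod n \<in> {- \<bar>n\<bar>..\<bar>n\<bar>}"
      using abs_mod_less[OF assms(2), of k] by auto
    then show "of_Z k \<in> of_Z ` {- \<bar>n\<bar>..\<bar>n\<bar>}"
      using mod[of k] by (rule image_eqI[rotated])
  qed
  then show ?thesis
    by (rule finite_subset) simp
qed

text \<open>Otherwise there would be finitely many integer values, hence finitely many fractions,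
  yet these fill the infinite carrier.\<close>

lemma of_Z_nonzero:
  assumes "minimal_algebra M" "admits_simple_fractions_closed M" "infinite (carrier M)" "n \<noteq> 0"
  shows "of_Z n \<noteq> \<zero>"
proof
  assume "of_Z n = \<zero>"
  then have "finite (range of_Z)"
    using assms(4) by (rule finite_range_of_Z)
  moreover have "carrier M \<subseteq> (\<lambda>(x, y). x \<otimes> recip y) ` (range of_Z \<times> range of_Z)"
    by (auto elim!: element_is_fraction[OF assms(1,2)])
  ultimately show False
    using assms(3) by (meson finite_SigmaI finite_imageI finite_subset)
qed

lemma of_Z_mult_recip:
  assumes "minimal_algebra M" "admits_simple_fractions_closed M" "infinite (carrier M)" "n \<noteq> 0"
  shows "of_Z n \<otimes> recip (of_Z n) = \<one>"
proof -
  let ?n = "of_Z n" and ?f = "\<one> \<ominus> of_Z n \<otimes> recip (of_Z n)"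
  obtain a b where ab: "?f = of_Z a \<otimes> recip (of_Z b)"
    using element_is_fraction[OF assms(1,2), of ?f] by auto
  have "?n \<otimes> ?f = ?n \<ominus> ?n \<otimes> ?n \<otimes> recip ?n"
    by (simp add: a_minus_def r_distr r_minus m_assoc)
  also have "\<dots> = \<zero>"
    by (simp add: mult_mult_recip a_minus_def r_neg)
  finally have nf: "?n \<otimes> ?f = \<zero>" .
  \<comment> \<open>Since \<open>b\<close> may be zero, it cannot be cancelled; expanding
    \<open>of_Z b\<close> by \<open>mult_mult_recip\<close> makes the fraction for \<open>?f\<close>
    appear instead.\<close>
  have "of_Z (n * a * b) = ?n \<otimes> of_Z a \<otimes> (of_Z b \<otimes> of_Z b \<otimes> recip (of_Z b))"
    by (simp add: of_Z_mult mult_mult_recip)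
  also have "\<dots> = ?n \<otimes> ?f \<otimes> (of_Z b \<otimes> of_Z b)"
    unfolding ab by (simp add: m_ac)
  also have "\<dots> = \<zero>"
    unfolding nf by simp
  finally have "n * a * b = 0"
    using of_Z_nonzero[OF assms(1-3)] by blast
  then have "a = 0 \<or> b = 0"
    using assms(4) by simp
  \<comment> \<open>For \<open>b = 0\<close> the fraction vanishes because
    \<open>recip \<zero>\<close> is zero.\<close>
  then have "?f = \<zero>"
    unfolding ab by (auto simp: recip_zero)
  then show ?thesis
    using minus_equality[of \<one> "\<ominus> (?n \<otimes> recip ?n)"] by (simp add: a_minus_def)
qed

section \<open>The embedding of the rationals\<close>

definition of_Q :: "rat \<Rightarrow> 'a" where
  "of_Q r = of_Z (fst (quotient_of r)) \<otimes> recip (of_Z (snd (quotient_of r)))"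

text \<open>Clearing denominators reduces sums and products of rationals to integer identities,
  since nonzero integers can be cancelled. Minimality gives surjectivity.\<close>

lemma sigma_isomorphic_Q0:
  assumes inv: "\<And>n. n \<noteq> 0 \<Longrightarrow> of_Z n \<otimes> recip (of_Z n) = \<one>"
    and minimal: "minimal_algebra M" and nontrivial: "\<one> \<noteq> \<zero>"
  shows "sigma_isomorphic Q0 M"
proof -
  have of_Q_closed [simp]: "of_Q r \<in> carrier M" for r
    by (simp add: of_Q_def)
  have cancel: "x = y" if "n \<noteq> 0" "x \<in> carrier M" "y \<in> carrier M"
    "x \<otimes> of_Z n = y \<otimes> of_Z n" for n x y
  proof -
    have "x \<otimes> of_Z n \<otimes> recip (of_Z n) = y \<otimes> of_Z n \<otimes> recip (of_Z n)"
      using that(4) by simp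
    then show ?thesis
      using that(1-3) by (simp add: m_assoc inv)
  qed
  \<comment> \<open>\<open>of_Q\<close> is defined through the reduced fraction;
    cross-multiplication makes every other representative usable as well.\<close>
  have mult_denom: "of_Q (Fract a b) \<otimes> of_Z b = of_Z a" if "b \<noteq> 0" for a b
  proof -
    obtain c d where cd: "quotient_of (Fract a b) = (c, d)" by fastforce
    then have d: "d \<noteq> 0" and "Fract a b = Fract c d"
      using quotient_of_denom_pos[OF cd] quotient_of_div[OF cd] by (auto simp: Fract_of_int_quotient)
    then have eq: "c * b = a * d"
      using that by (simp add: eq_rat)
    have "of_Q (Fract a b) \<otimes> of_Z b \<otimes> of_Z d
        = of_Z c \<otimes> of_Z b \<otimes> (of_Z d \<otimes> recip (of_Z d))"
      by (simp add: of_Q_def cd m_ac)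
    also have "\<dots> = of_Z a \<otimes> of_Z d"
      using d eq by (simp add: inv flip: of_Z_mult)
    finally show ?thesis
      using cancel d by simp
  qed
  have of_Q_eqI: "of_Q (Fract a b) = x" if "b \<noteq> 0" "x \<in> carrier M" "x \<otimes> of_Z b = of_Z a" for a b x
    using cancel[of b "of_Q (Fract a b)" x] that mult_denom[of b a] by simp
  have of_Q_add: "of_Q (r + s) = of_Q r \<oplus> of_Q s" for r s
  proof (cases r, cases s)
    fix a b c d assume rs: "r = Fract a b" "s = Fract c d" and pos: "b > 0" "d > 0"
    have "(of_Q r \<oplus> of_Q s) \<otimes> of_Z (b * d)
        = of_Q r \<otimes> of_Z b \<otimes> of_Z d \<oplus> of_Q s \<otimes> of_Z d \<otimes> of_Z b"
      by (simp add: of_Z_mult r_distr m_ac)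
    also have "\<dots> = of_Z (a * d + c * b)"
      using pos by (simp add: rs mult_denom of_Z_add of_Z_mult)
    finally show ?thesis
      using pos by (simp add: rs of_Q_eqI)
  qed
  have of_Q_mult: "of_Q (r * s) = of_Q r \<otimes> of_Q s" for r s
  proof (cases r, cases s)
    fix a b c d assume rs: "r = Fract a b" "s = Fract c d" and pos: "b > 0" "d > 0"
    have "(of_Q r \<otimes> of_Q s) \<otimes> of_Z (b * d) = (of_Q r \<otimes> of_Z b) \<otimes> (of_Q s \<otimes> of_Z d)"
      by (simp add: of_Z_mult m_ac)
    also have "\<dots> = of_Z (a * c)"
      using pos by (simp add: rs mult_denom of_Z_mult)
    finally show ?thesis
      using pos by (simp add: rs of_Q_eqI)
  qed
  have of_Q_0: "of_Q 0 = \<zero>"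
    using of_Q_eqI[of 1 \<zero> 0] by (simp add: Zero_rat_def)
  have of_Q_1: "of_Q 1 = \<one>"
    using of_Q_eqI[of 1 \<one> 1] by (simp add: One_rat_def)
  have of_Q_neg: "of_Q (- r) = neg M (of_Q r)" for r
    using of_Q_add[of "- r" r] by (simp add: neg_eq of_Q_0 minus_equality)
  have of_Q_inverse: "of_Q (inverse r) = recip (of_Q r)" for r
  \<comment> \<open>At zero, the convention \<open>inverse 0 = 0\<close> matches
    \<open>recip_zero\<close>; elsewhere \<open>recip_unique\<close> applies.\<close>
  proof (cases "r = 0")
    case False
    then have "of_Q r \<otimes> of_Q (inverse r) = \<one>"
      by (simp add: of_Q_1 flip: of_Q_mult)
    then show ?thesis
      using recip_unique[of "of_Q r" "of_Q (inverse r)"] by simp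
  qed (simp add: of_Q_0 recip_zero)
  have of_Q_divide: "of_Q (r / s) = quot M (of_Q r) (of_Q s)" for r s
    by (simp add: divide_inverse of_Q_mult of_Q_inverse quot_eq[of "of_Q r"])
  have "r = s" if "of_Q r = of_Q s" for r s
  proof (rule ccontr)
    assume "r \<noteq> s"
    have "of_Q (r - s) = \<zero>"
      using that of_Q_add[of r "- s"] by (simp add: of_Q_neg neg_eq r_neg)
    \<comment> \<open>The argument equals one, as \<open>r - s\<close> is nonzero, so
      \<open>\<one>\<close> would be zero.\<close>
    then have "of_Q ((r - s) * inverse (r - s)) = \<zero>"
      by (simp add: of_Q_mult)
    then show False
      using \<open>r \<noteq> s\<close> nontrivial by (simp add: of_Q_1)
  qed
  then have "inj of_Q"
    by (rule injI)
  moreover have "range of_Q = carrier M"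
  proof (rule minimal_algebra_carrier_eq[OF minimal])
    show "closed_under_ops M (range of_Q)"
      by (auto simp: closed_under_ops_def simp flip: of_Q_0 of_Q_1 of_Q_add of_Q_mult of_Q_divide of_Q_neg)
  qed auto
  ultimately have "of_Q \<in> sigma_iso Q0 M"
    by (simp add: sigma_iso_def bij_betw_def Q0_def of_Q_0 of_Q_1 of_Q_add of_Q_mult
        of_Q_divide of_Q_neg)
  then show ?thesis
    by (auto simp: sigma_isomorphic_def)
qed

end

theorem theorem17:
  fixes M :: "'a sigma"
  assumes "divisive_meadow M"
    and "infinite (carrier M)"
    and "minimal_algebra M"
    and "admits_simple_fractions_closed M"
  shows "sigma_isomorphic M Q0"
proof -
  interpret meadow M
    using assms(1) by (rule divisive_meadow_imp_meadow)
  \<comment> \<open>The zero ring has a single element, so its carrier is finite.\<close>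
  have "\<one>\<^bsub>M\<^esub> \<noteq> \<zero>\<^bsub>M\<^esub>"
    using assms(2) one_zeroD by auto
  then have "sigma_isomorphic Q0 M"
    using of_Z_mult_recip[OF assms(3,4,2)] assms(3) by (intro sigma_isomorphic_Q0)
  then show ?thesis
    by (rule sigma_isomorphic_sym) (simp add: sigma_algebra_def closed_under_ops_def Q0_def)
qed

end
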